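(* Let $p>0$ and let $W\subsetneq\mathbb{C}$ be a simply connected domain with $\mathcal{H}_p(W)<\infty$. Suppose that $f$ is an analytic function on $W$ such that $\limsup_{z\to\partial W}|f(z)|\le K<\infty$, and such that $|f(z)|\le Ce^{C|z|^{p}}$ for all $z\in W$, for some constant $C>0$. Then $|f(z)|\le K$ for all $z\in W$.
   Context: Let $\mathbb{D}=\{z\in\mathbb{C}:|z|<1\}$. For a simply connected domain $W\subsetneq\mathbb{C}$ and $a\in W$, let $\phi_a:\mathbb{D}\to W$ be a conformal map of $\mathbb{D}$ onto $W$ with $\phi_a(0)=a$ (unique up to precomposition with a rotation). For $p>0$ set $$\mathcal{H}^a_p(W)=\|\phi_a\|_{H^p}:=\Big(\sup_{0\le r<1}\frac{1}{2\pi}\int_0^{2\pi}|\phi_a(re^{i\theta})|^p\,d\theta\Big)^{1/p}\in[0,\infty].$$ This value does not depend on the choice of $\phi_a$, and for $a,b\in W$ the quantities $\mathcal{H}^a_p(W),\mathcal{H}^b_p(W)$ are either both finite or both infinite. One writes $\mathcal{H}_p(W)<\infty$ if $\mathcal{H}^a_p(W)<\infty$ for some (equivalently every) $a\in W$. $\partial W$ denotes the boundary of $W$ in $\mathbb{C}$ (the point at infinity is not included), and $\limsup_{z\to\partial W}|f(z)|\le K$ means that $\limsup_{z\to\zeta,\,z\in W}|f(z)|\le K$ for every $\zeta\in\partial W$. *)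

theory Defs
  imports "HOL-Complex_Analysis.Complex_Analysis"
begin

definition conformal_onto :: "(complex \<Rightarrow> complex) \<Rightarrow> complex set \<Rightarrow> complex set \<Rightarrow> bool" where
  "conformal_onto \<phi> U V \<longleftrightarrow> \<phi> holomorphic_on U \<and> inj_on \<phi> U \<and> \<phi> ` U = V"

definition integral_mean :: "real \<Rightarrow> (complex \<Rightarrow> complex) \<Rightarrow> real \<Rightarrow> real" where
  "integral_mean p \<phi> r =
     1 / (2 * pi) * integral {0..2 * pi} (\<lambda>\<theta>. norm (\<phi> (of_real r * cis \<theta>)) powr p)"

definition ennreal_powr :: "ennreal \<Rightarrow> real \<Rightarrow> ennreal" where
  "ennreal_powr x s = (if x = \<infinity> then \<infinity> else ennreal (enn2real x powr s))"
    \<comment> \<open>Only meant for exponents \<open>s > 0\<close>.\<close>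

definition hardy_norm :: "real \<Rightarrow> (complex \<Rightarrow> complex) \<Rightarrow> ennreal" where
  "hardy_norm p \<phi> = ennreal_powr (SUP r\<in>{0..<1}. ennreal (integral_mean p \<phi> r)) (1 / p)"

text \<open>For a simply connected domain \<open>W \<noteq> UNIV\<close> and \<open>a \<in> W\<close> a map as chosen below exists by the
  Riemann mapping theorem, and it is unique up to precomposition with a rotation, which does not
  change the Hardy norm.\<close>

definition riemann_map :: "complex set \<Rightarrow> complex \<Rightarrow> complex \<Rightarrow> complex" where
  "riemann_map W a = (SOME \<phi>. conformal_onto \<phi> (ball 0 1) W \<and> \<phi> 0 = a)"

definition domain_hardy_norm :: "real \<Rightarrow> complex \<Rightarrow> complex set \<Rightarrow> ennreal" where
  "domain_hardy_norm p a W = hardy_norm p (riemann_map W a)"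

definition finite_hardy :: "real \<Rightarrow> complex set \<Rightarrow> bool" where
  "finite_hardy p W \<longleftrightarrow> (\<exists>a\<in>W. domain_hardy_norm p a W < \<infinity>)"

end

theory Submission
  imports Defs
begin

text \<open>
  Let \<open>\<phi>\<close> be the Riemann map of \<open>W\<close> and fix \<open>K' > K\<close>. The function \<open>v = ln\<^sup>+ |f \<circ> \<phi> / K'|\<close> is subharmonic
  and nonnegative in the unit disc. By the growth condition it is at most a constant plus a
  multiple of \<open>|\<phi>|\<close> to the power \<open>p\<close>. By the boundary condition \<open>|f| < K'\<close> near every finite boundary point, so
  \<open>{v > 0} \<inter> {|\<phi>| \<le> R}\<close> lies in a compact part of the disc, for every \<open>R\<close>. On a circle of radius
  near \<open>1\<close>, therefore, \<open>v\<close> lives only where \<open>|\<phi>|\<close> is large. A function of class \<open>H\<^sup>p\<close> has uniformly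
  integrable \<open>p\<close>-th powers on circles, so the means of \<open>v\<close> over circles tend to \<open>0\<close>; as they increase with
  the radius and \<open>v \<ge> 0\<close>, this forces \<open>v = 0\<close>, that is, \<open>|f| \<le> K'\<close>.
  
  Since \<open>W\<close> omits a point \<open>w0\<close>, uniform integrability can be had without the theory of Hardy spaces.
  The function \<open>h = (\<phi> - w0) powr (p / 2)\<close> is holomorphic (\<open>hardy_root\<close>) with bounded quadratic means,
  so its Taylor coefficients are square summable (\<open>square_summable_taylor\<close>), and \<open>h\<close> is a bounded
  polynomial plus a remainder of small quadratic mean. Where \<open>|h|\<close> is large, it is at most twice the
  remainder, which gives an upper bound for \<open>v\<close> of arbitrarily small mean.
  
  Subharmonicity is used in a finite form, with averages over \<open>n\<close> rotated points in place of integrals.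
  The maximum principle for suitable products of rotations bounds such an average inside the disc by
  averages on a circle (\<open>sum_log_plus_rotations_le\<close>), and the latter are computed exactly by
  \<open>discrete_parseval\<close>. If \<open>v\<close> were positive at a point, then a fixed proportion of its rotations would
  contribute a fixed amount (\<open>sum_log_plus_rotations_ge\<close>), for every \<open>n\<close>. The lemma
  \<open>phragmen_lindelof_disc\<close> combines these bounds; the theorem transports it to \<open>W\<close>, where
  \<open>compact_superlevel\<close> expresses the boundary condition.
\<close>

section \<open>Parseval identities on circles\<close>

text \<open>
  The characters of the \<open>n\<close>-th roots of unity are orthogonal: for \<open>m \<noteq> l\<close> the summands are the powers of
  an \<open>n\<close>-th root of unity different from \<open>1\<close>, and their geometric sum vanishes. The bound \<open>m, l < n\<close>
  excludes aliasing, that is, different exponents which agree modulo \<open>n\<close>.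
\<close>

lemma sum_unit_circle_character:
  fixes m l n :: nat
  assumes "m < n" "l < n"
  shows "(\<Sum>k<n. cis (2 * pi * k / n) ^ m * cnj (cis (2 * pi * k / n)) ^ l) = (if m = l then of_nat n else 0)"
proof -
  define x where "x = cis (2 * pi * m / n) * cnj (cis (2 * pi * l / n))"
  have n: "n > 0" using assms by simp
  have term_eq: "cis (2 * pi * k / n) ^ m * cnj (cis (2 * pi * k / n)) ^ l = x ^ k" for k
    unfolding x_def power_mult_distrib complex_cnj_power [symmetric] Complex.DeMoivre
    by (simp add: mult_ac)
  show ?thesis
  proof (cases "m = l")
    case True
    then have "x = 1" by (simp add: x_def cis_cnj cis_mult)
    then show ?thesis using True unfolding term_eq by simp
  next
    case False
    have "cis (2 * pi * m / n) \<noteq> cis (2 * pi * l / n)"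
    proof
      assume "cis (2 * pi * m / n) = cis (2 * pi * l / n)"
      then have "exp (2 * of_real pi * \<i> * of_nat m / of_nat n) = exp (2 * of_real pi * \<i> * of_nat l / of_nat n)"
        by (simp add: cis_conv_exp mult_ac)
      then have "m mod n = l mod n"
        using complex_root_unity_eq[of n m l] n by simp
      then show False using assms False by simp
    qed
    moreover have "x * cis (2 * pi * l / n) = cis (2 * pi * m / n)"
      by (simp add: x_def cis_cnj cis_mult)
    ultimately have "x \<noteq> 1" by auto
    moreover have "x ^ n = 1"
    proof -
      have 1: "cis (2 * pi * j / n) ^ n = 1" for j :: nat
        using n by (simp add: Complex.DeMoivre cis_multiple_2pi[of "real j"])
      show ?thesis unfolding x_def power_mult_distrib complex_cnj_power [symmetric]
        by (simp only: 1) simp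
    qed
    ultimately show ?thesis
      using False unfolding term_eq by (simp add: geometric_sum)
  qed
qed

lemma of_real_norm_poly_squared:
  fixes a :: "nat \<Rightarrow> complex"
  shows "of_real ((norm (\<Sum>m<n. a m * (w * z) ^ m))\<^sup>2) =
    (\<Sum>m<n. \<Sum>l<n. (a m * z ^ m) * cnj (a l * z ^ l) * (w ^ m * cnj w ^ l))"
  unfolding complex_norm_square
  by (simp add: sum_product power_mult_distrib mult_ac)

lemma of_real_norm_coeff:
  fixes a :: "nat \<Rightarrow> complex" and z :: complex
  shows "(a m * z ^ m) * cnj (a m * z ^ m) = of_real ((norm (a m))\<^sup>2 * norm z ^ (2 * m))"
proof -
  have "(norm (a m * z ^ m))\<^sup>2 = (norm (a m))\<^sup>2 * norm z ^ (2 * m)"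
    unfolding power_even_eq norm_mult norm_power by (rule power_mult_distrib)
  then show ?thesis
    unfolding complex_norm_square [of "a m * z ^ m", symmetric] by (rule arg_cong)
qed

text \<open>
  For a polynomial of degree below \<open>n\<close>, the average of the squared modulus over \<open>n\<close> equally spaced
  points of a circle is exact: it is already the integral mean. This allows the subharmonicity
  argument below to work with finite averages, for which the maximum principle applies to a
  plain product.
\<close>

lemma discrete_parseval:
  fixes a :: "nat \<Rightarrow> complex" and z :: complex
  shows "(\<Sum>k<n. (norm (\<Sum>m<n. a m * (cis (2 * pi * real k / real n) * z) ^ m))\<^sup>2) =
         n * (\<Sum>m<n. (norm (a m))\<^sup>2 * norm z ^ (2 * m))"
proof -
  let ?c = "\<lambda>m l. (a m * z ^ m) * cnj (a l * z ^ l)"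
  have "complex_of_real (\<Sum>k<n. (norm (\<Sum>m<n. a m * (cis (2 * pi * real k / real n) * z) ^ m))\<^sup>2) =
     (\<Sum>k<n. \<Sum>m<n. \<Sum>l<n. ?c m l * (cis (2 * pi * real k / real n) ^ m * cnj (cis (2 * pi * real k / real n)) ^ l))"
    by (simp only: of_real_sum of_real_norm_poly_squared)
  also have "\<dots> = (\<Sum>m<n. \<Sum>l<n. ?c m l * (\<Sum>k<n. cis (2 * pi * real k / real n) ^ m * cnj (cis (2 * pi * real k / real n)) ^ l))"
    unfolding sum_distrib_left
    by (rule trans[OF sum.swap], rule sum.cong[OF refl], rule sum.swap)
  also have "\<dots> = (\<Sum>m<n. \<Sum>l<n. if m = l then of_nat n * ?c m l else 0)"
    by (intro sum.cong refl, subst sum_unit_circle_character) auto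
  also have "\<dots> = (\<Sum>m<n. of_nat n * ?c m m)"
    by simp
  also have "\<dots> = of_real (n * (\<Sum>m<n. (norm (a m))\<^sup>2 * norm z ^ (2 * m)))"
    unfolding of_real_norm_coeff by (simp add: sum_distrib_left)
  finally show ?thesis by (simp only: of_real_eq_iff)
qed

lemma has_integral_unit_circle_character:
  "((\<lambda>t. cis t ^ m * cnj (cis t) ^ l) has_integral (if m = l then 2 * of_real pi else 0)) {0..2 * pi}"
proof -
  have eq: "cis t ^ m * cnj (cis t) ^ l = exp (\<i> * of_int (int m - int l) * of_real t)" for t
    unfolding complex_cnj_power [symmetric] Complex.DeMoivre
    by (simp add: cis_cnj cis_mult) (simp add: cis_conv_exp algebra_simps)
  show ?thesis
  proof (cases "m = l")
    case True
    have "((\<lambda>t::real. 1::complex) has_integral (2 * pi - 0) *\<^sub>R 1) {0..2 * pi}"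
      using has_integral_const_real[of "1::complex" 0 "2*pi"] by simp
    then show ?thesis using True unfolding eq by (simp add: scaleR_conv_of_real)
  next
    case False
    define j :: complex where "j = \<i> * of_int (int m - int l)"
    have j: "j \<noteq> 0" using False by (simp add: j_def)
    have "((\<lambda>z. exp (j * z) / j) has_field_derivative exp (j * z)) (at z)" for z
      using j by (auto intro!: derivative_eq_intros)
    from has_vector_derivative_real_field[OF this]
    have "((\<lambda>t. exp (j * of_real t)) has_integral
        (exp (j * of_real (2 * pi)) / j - exp (j * of_real 0) / j)) {0..2 * pi}"
      by (intro fundamental_theorem_of_calculus) auto
    moreover have "exp (j * of_real (2 * pi)) = 1"
    proof -
      have "j * of_real (2 * pi) = \<i> * (of_int (int m - int l) * (of_real pi * 2))"
        by (simp add: j_def)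
      then show ?thesis by (simp only: exp_2pi_1_int)
    qed
    ultimately show ?thesis using False unfolding eq j_def [symmetric] by simp
  qed
qed

text \<open>
  The continuous counterpart is needed only to read off, from the bounded integral means, that the
  Taylor coefficients are square summable.
\<close>

lemma parseval_polynomial:
  fixes a :: "nat \<Rightarrow> complex" and r :: real
  assumes "r \<ge> 0"
  shows "((\<lambda>t. (norm (\<Sum>m<n. a m * (of_real r * cis t) ^ m))\<^sup>2) has_integral
          2 * pi * (\<Sum>m<n. (norm (a m))\<^sup>2 * r ^ (2 * m))) {0..2 * pi}"
proof -
  let ?c = "\<lambda>m l. (a m * of_real r ^ m) * cnj (a l * of_real r ^ l)"
  have "((\<lambda>t. \<Sum>m<n. \<Sum>l<n. ?c m l * (cis t ^ m * cnj (cis t) ^ l)) has_integral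
     (\<Sum>m<n. \<Sum>l<n. ?c m l * (if m = l then 2 * of_real pi else 0))) {0..2 * pi}"
    by (intro has_integral_sum has_integral_mult_right has_integral_unit_circle_character) auto
  moreover have "(\<Sum>m<n. \<Sum>l<n. ?c m l * (if m = l then 2 * of_real pi else 0)) =
      of_real (2 * pi * (\<Sum>m<n. (norm (a m))\<^sup>2 * r ^ (2 * m)))" (is "?l = ?r")
  proof -
    have "?l = (\<Sum>m<n. \<Sum>l<n. if m = l then 2 * of_real pi * ?c m l else 0)"
      by (intro sum.cong refl) simp
    also have "\<dots> = (\<Sum>m<n. 2 * of_real pi * ?c m m)"
      by simp
    also have "\<dots> = ?r"
      unfolding of_real_norm_coeff using assms by (simp add: sum_distrib_left)
    finally show ?thesis .
  qed
  moreover have "(\<Sum>m<n. \<Sum>l<n. ?c m l * (cis t ^ m * cnj (cis t) ^ l)) =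
      of_real ((norm (\<Sum>m<n. a m * (of_real r * cis t) ^ m))\<^sup>2)" for t
    using of_real_norm_poly_squared[of a "cis t" "of_real r" n] by (simp only: mult.commute[of "of_real r"])
  ultimately have "((\<lambda>t. complex_of_real ((norm (\<Sum>m<n. a m * (of_real r * cis t) ^ m))\<^sup>2)) has_integral
     of_real (2 * pi * (\<Sum>m<n. (norm (a m))\<^sup>2 * r ^ (2 * m)))) {0..2 * pi}"
    by simp
  from has_integral_Re[OF this] show ?thesis by simp
qed

section \<open>Taylor coefficients of a function with bounded quadratic means\<close>

lemma taylor_uniform_limit:
  assumes "h holomorphic_on ball 0 1" "r < 1"
  shows "uniform_limit (cball 0 r) (\<lambda>n z. \<Sum>m<n. ((deriv ^^ m) h 0 / fact m) * z ^ m) h sequentially"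
proof -
  let ?a = "\<lambda>m. (deriv ^^ m) h 0 / fact m"
  have sums: "(\<lambda>m. ?a m * z ^ m) sums h z" if "norm z < 1" for z
    using holomorphic_power_series[OF assms(1), of z] that by simp
  have "conv_radius ?a \<ge> 1"
  proof (rule conv_radius_geI_ex)
    fix s :: real assume "0 < s" "ereal s < 1"
    then show "\<exists>z. norm z = s \<and> summable (\<lambda>m. ?a m * z ^ m)"
      using sums[of "of_real s"] by (intro exI[of _ "of_real s"]) (auto simp: sums_iff)
  qed
  moreover have "ereal r < 1"
    using assms(2) by (simp add: one_ereal_def)
  ultimately have "ereal r < conv_radius ?a"
    by (rule less_le_trans [rotated])
  from powser_uniform_limit[OF this, of 0]
  have "uniform_limit (cball 0 r) (\<lambda>n z. \<Sum>m<n. ?a m * z ^ m) (\<lambda>z. \<Sum>m. ?a m * z ^ m) sequentially"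
    by simp
  moreover have "(\<Sum>m. ?a m * z ^ m) = h z" if "z \<in> cball 0 r" for z
    using sums_unique[OF sums[of z]] that assms(2) by simp
  ultimately show ?thesis
    using uniform_limit_cong'[OF refl, of "cball 0 r" "\<lambda>z. \<Sum>m. ?a m * z ^ m" h] by blast
qed

text \<open>
  On a circle of radius \<open>r < 1\<close> the Taylor polynomials converge uniformly, so their quadratic means,
  which increase with the degree, converge to that of \<open>h\<close> and share its bound. Since this bound does
  not depend on \<open>r\<close>, it survives the limit \<open>r \<rightarrow> 1\<close> in each partial sum.
\<close>

lemma square_summable_taylor:
  assumes hol: "h holomorphic_on ball 0 1"
    and bdd: "\<And>r. 0 < r \<Longrightarrow> r < 1 \<Longrightarrow> integral {0..2 * pi} (\<lambda>t. (norm (h (of_real r * cis t)))\<^sup>2) \<le> B"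
  shows "summable (\<lambda>m. (norm ((deriv ^^ m) h 0 / fact m))\<^sup>2)"
proof -
  let ?a = "\<lambda>m. (deriv ^^ m) h 0 / fact m"
  have partial: "2 * pi * (\<Sum>m<N. (norm (?a m))\<^sup>2 * r ^ (2 * m)) \<le> B" if r: "0 < r" "r < 1" for r N
  proof -
    have "uniform_limit {0..2 * pi} (\<lambda>n t. \<Sum>m<n. ?a m * (of_real r * cis t) ^ m)
             (\<lambda>t. h (of_real r * cis t)) sequentially"
      by (rule uniform_limit_compose'[OF taylor_uniform_limit[OF hol r(2)]])
         (use r in \<open>auto simp: norm_mult\<close>)
    moreover have "compact ((\<lambda>t. h (of_real r * cis t)) ` {0..2 * pi})"
      using r by (intro compact_continuous_image continuous_intros
          continuous_on_compose2[OF holomorphic_on_imp_continuous_on[OF hol]]) (auto simp: norm_mult)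
    ultimately have "uniform_limit {0..2 * pi} (\<lambda>n t. (norm (\<Sum>m<n. ?a m * (of_real r * cis t) ^ m))\<^sup>2)
             (\<lambda>t. (norm (h (of_real r * cis t)))\<^sup>2) sequentially"
      unfolding power2_eq_square
      by (intro uniform_lim_mult uniform_limit_intros)
         (auto simp: image_image bounded_norm_comp dest!: compact_imp_bounded)
    then obtain I J where IJ: 
        "\<And>n. ((\<lambda>t. (norm (\<Sum>m<n. ?a m * (of_real r * cis t) ^ m))\<^sup>2) has_integral I n) {0..2 * pi}"
        "((\<lambda>t. (norm (h (of_real r * cis t)))\<^sup>2) has_integral J) {0..2 * pi}" "I \<longlonglongrightarrow> J"
      by (rule uniform_limit_integral) (auto intro!: continuous_intros)
    have I: "I n = 2 * pi * (\<Sum>m<n. (norm (?a m))\<^sup>2 * r ^ (2 * m))" for n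
      using has_integral_unique[OF IJ(1) parseval_polynomial] r by simp
    have "incseq I"
      unfolding I by (intro incseq_SucI) simp
    then have "I N \<le> J" using IJ(3) by (rule incseq_le)
    also have "J \<le> B" using bdd[OF r] IJ(2) by (simp add: integral_unique)
    finally show ?thesis by (simp add: I)
  qed
  have "(\<Sum>m<N. (norm (?a m))\<^sup>2) \<le> B / (2 * pi)" for N
  proof (rule tendsto_upperbound)
    show "((\<lambda>r. \<Sum>m<N. (norm (?a m))\<^sup>2 * r ^ (2 * m)) \<longlongrightarrow> (\<Sum>m<N. (norm (?a m))\<^sup>2)) (at_left (1::real))"
      by (rule tendsto_eq_intros refl | simp)+
    show "\<forall>\<^sub>F r in at_left 1. (\<Sum>m<N. (norm (?a m))\<^sup>2 * r ^ (2 * m)) \<le> B / (2 * pi)"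
      unfolding eventually_at_left_field
      by (intro exI[of _ 0]) (use partial in \<open>auto simp: field_simps\<close>)
  qed simp
  then show ?thesis
    by (intro bounded_imp_summable[of _ "B / (2 * pi)"])
      (simp_all only: lessThan_Suc_atMost [symmetric] zero_le_power2)
qed

section \<open>Averages over rotated points\<close>

text \<open>
  This is a maximum principle for \<open>z \<mapsto> \<Sum>k\<in>I. ln\<^sup>+ |g (w k * z)|\<close>, a subharmonic function. At the given
  point \<open>z0\<close> only the indices with \<open>|g (w k * z0)| > 1\<close> contribute. The product of the corresponding
  factors is holomorphic, its logarithm at \<open>z0\<close> is the whole sum, and everywhere else it is at most
  the sum, because the omitted terms are nonnegative.
\<close>

lemma sum_log_plus_rotations_le:
  fixes g :: "complex \<Rightarrow> complex" and w :: "'i \<Rightarrow> complex"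
  assumes hol: "g holomorphic_on ball 0 r" and cont: "continuous_on (cball 0 r) g"
    and fin: "finite I" and w: "\<And>k. k \<in> I \<Longrightarrow> norm (w k) = 1"
    and le: "\<And>z. norm z = r \<Longrightarrow> (\<Sum>k\<in>I. ln (max 1 (norm (g (w k * z))))) \<le> B"
    and z0: "norm z0 < r"
  shows "(\<Sum>k\<in>I. ln (max 1 (norm (g (w k * z0))))) \<le> B"
proof -
  define S where "S = {k\<in>I. norm (g (w k * z0)) > 1}"
  have S: "finite S" "S \<subseteq> I" using fin by (auto simp: S_def)
  define G where "G = (\<lambda>z. \<Prod>k\<in>S. g (w k * z))"
  have r: "r > 0" using z0 norm_ge_zero[of z0] by linarith
  have "norm (G z0) \<le> exp B"
  proof (rule maximum_modulus_frontier[of G "cball 0 r"])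
    show "G holomorphic_on interior (cball 0 r)"
      unfolding G_def using w S
      by (intro holomorphic_intros holomorphic_on_compose_gen[OF _ hol, unfolded o_def])
         (auto simp: norm_mult)
    show "continuous_on (closure (cball 0 r)) G"
      unfolding G_def using w S
      by (intro continuous_intros continuous_on_compose2[OF cont])
         (auto simp: norm_mult)
    show "norm (G z) \<le> exp B" if "z \<in> frontier (cball 0 r)" for z
    proof -
      have z: "norm z = r" using that r by (simp add: dist_norm)
      have "norm (G z) \<le> (\<Prod>k\<in>S. max 1 (norm (g (w k * z))))"
        unfolding G_def prod_norm [symmetric] by (intro prod_mono) auto
      also have "\<dots> = exp (\<Sum>k\<in>S. ln (max 1 (norm (g (w k * z)))))"
        using S by (simp add: exp_sum)
      also have "\<dots> \<le> exp (\<Sum>k\<in>I. ln (max 1 (norm (g (w k * z)))))"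
        using S fin by (intro exp_le_cancel_iff[THEN iffD2] sum_mono2) auto
      also have "\<dots> \<le> exp B" using le[OF z] by simp
      finally show ?thesis .
    qed
  qed (use z0 in auto)
  moreover have "norm (G z0) = exp (\<Sum>k\<in>S. ln (max 1 (norm (g (w k * z0)))))"
    using S by (simp add: exp_sum G_def prod_norm [symmetric]) (auto intro!: prod.cong simp: S_def)
  moreover have "(\<Sum>k\<in>S. ln (max 1 (norm (g (w k * z0))))) = (\<Sum>k\<in>I. ln (max 1 (norm (g (w k * z0)))))"
    using S fin by (intro sum.mono_neutral_left) (auto simp: S_def not_less max_absorb1)
  ultimately show ?thesis by simp
qed

text \<open>
  By continuity \<open>ln\<^sup>+ |g|\<close> stays above a positive constant near \<open>z0\<close>, and a fixed proportion of the
  \<open>n\<close> rotated points, those of angle below a fixed bound, lie in that neighbourhood. Hence the average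
  of \<open>ln\<^sup>+ |g|\<close> over the rotated points stays away from \<open>0\<close> as \<open>n\<close> grows. This extracts pointwise
  information on the whole disc from means over circles about the origin.
\<close>

lemma sum_log_plus_rotations_ge:
  fixes g :: "complex \<Rightarrow> complex"
  assumes cont: "isCont g z0" and z0: "norm z0 \<le> 1" "norm (g z0) > 1"
  obtains c :: real where "c > 0"
    "\<And>n::nat. real n * c \<le> (\<Sum>k<n. ln (max 1 (norm (g (cis (2 * pi * real k / real n) * z0)))))"
proof -
  obtain s where s: "1 < s" "s < norm (g z0)" using z0 dense by blast
  have "\<forall>\<^sub>F z in nhds z0. s < norm (g z)"
    using order_tendstoD(1)[OF tendsto_norm[OF cont[unfolded continuous_at]] s(2)] s(2)
    by (auto simp: eventually_at_filter elim: eventually_mono)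
  then obtain d where d: "d > 0" "\<And>z. dist z z0 < d \<Longrightarrow> s < norm (g z)"
    unfolding eventually_nhds_metric by auto
  \<comment> \<open>The proportion of points with angle below \<open>d\<close>; rotating by an angle moves a point of
    the unit disc by at most that angle.\<close>
  define e where "e = min 1 (d / (2 * pi))"
  have e: "0 < e" "e \<le> 1" "2 * pi * e \<le> d" using d(1) by (auto simp: e_def min_def field_simps)
  show ?thesis
  proof (rule that[of "e * ln s"])
    show "e * ln s > 0" using e s by simp
    fix n :: nat
    define j where "j = nat \<lceil>n * e\<rceil>"
    have jn: "j \<le> n" using e by (simp add: j_def ceiling_le_iff mult_left_le)
    have "n * (e * ln s) \<le> (\<Sum>k<j. ln s)"
      using e s by (simp add: j_def mult_right_mono flip: mult.assoc)
    also have "\<dots> \<le> (\<Sum>k<j. ln (max 1 (norm (g (cis (2 * pi * real k / real n) * z0)))))"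
    proof (rule sum_mono)
      fix k assume "k \<in> {..<j}"
      then have k: "k < n * e" unfolding j_def by (simp add: nat_less_iff less_ceiling_iff zless_nat_eq_int_zless)
      then have n: "n > 0" using e by (cases n) auto
      have "dist (cis (2 * pi * real k / real n) * z0) z0 = norm (cis (2 * pi * real k / real n) - 1) * norm z0"
        by (simp add: dist_norm norm_mult [symmetric] algebra_simps)
      also have "\<dots> \<le> norm (cis (2 * pi * real k / real n) - 1)"
        using z0 by (simp add: mult_left_le)
      also have "\<dots> = 2 * \<bar>sin ((2 * pi * real k / real n) / 2)\<bar>"
        using dist_exp_i_1[of "2 * pi * real k / real n"] by (simp add: cis_conv_exp)
      also have "\<dots> \<le> 2 * pi * real k / real n"
        using abs_sin_x_le_abs_x[of "(2 * pi * real k / real n) / 2"] by simp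
      also have "\<dots> < 2 * pi * e"
        using k n by (simp add: field_simps)
      finally have "s < norm (g (cis (2 * pi * real k / real n) * z0))" using d e by auto
      then show "ln s \<le> ln (max 1 (norm (g (cis (2 * pi * real k / real n) * z0))))"
        using s by (subst ln_le_cancel_iff) auto
    qed
    also have "\<dots> \<le> (\<Sum>k<n. ln (max 1 (norm (g (cis (2 * pi * real k / real n) * z0)))))"
      using jn by (intro sum_mono2) auto
    finally show "n * (e * ln s) \<le> (\<Sum>k<n. ln (max 1 (norm (g (cis (2 * pi * real k / real n) * z0)))))" .
  qed
qed

section \<open>A maximum principle in the disc\<close>

text \<open>
  Here \<open>h\<close> has bounded quadratic means and \<open>|h|\<^sup>2\<close> controls \<open>ln\<^sup>+ |g|\<close>; near the unit circle \<open>|g|\<close> can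
  exceed \<open>1\<close> only where \<open>|h|\<close> is large. There \<open>h\<close> dominates any fixed Taylor polynomial \<open>T N\<close> of itself, as
  polynomials are bounded on the disc, so that \<open>|h| \<le> 2 * |h - T N|\<close> and the remainder \<open>h - T N\<close> can
  take the place of \<open>h\<close> in the bound for \<open>ln\<^sup>+ |g|\<close>. The quadratic mean of the remainder is as small as
  desired when \<open>N\<close> is large, uniformly in the radius. So the averages of \<open>ln\<^sup>+ |g|\<close> over rotated points
  are arbitrarily small, while they would stay above a positive constant if
  \<open>|g| > 1\<close> somewhere.
\<close>

lemma phragmen_lindelof_disc:
  fixes g h :: "complex \<Rightarrow> complex" and A c B :: real
  assumes holg: "g holomorphic_on ball 0 1" and holh: "h holomorphic_on ball 0 1"
    and bdd: "\<And>r. 0 < r \<Longrightarrow> r < 1 \<Longrightarrow> integral {0..2 * pi} (\<lambda>t. (norm (h (of_real r * cis t)))\<^sup>2) \<le> B"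
    and Ac: "A \<ge> 0" "c \<ge> 0"
    and growth: "\<And>z. norm z < 1 \<Longrightarrow> norm (g z) \<le> exp (A + c * (norm (h z))\<^sup>2)"
    and bdry: "\<And>M. \<exists>\<rho><1. \<forall>z. \<rho> \<le> norm z \<longrightarrow> norm z < 1 \<longrightarrow> norm (g z) > 1 \<longrightarrow> M \<le> norm (h z)"
    and z0: "norm z0 < 1"
  shows "norm (g z0) \<le> 1"
proof (rule ccontr)
  assume "\<not> norm (g z0) \<le> 1"
  moreover have "isCont g z0"
    using holomorphic_on_imp_continuous_on[OF holg] z0
    by (simp add: continuous_on_eq_continuous_at)
  ultimately obtain e where e: "e > 0"
    "\<And>n::nat. real n * e \<le> (\<Sum>k<n. ln (max 1 (norm (g (cis (2 * pi * real k / real n) * z0)))))"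
    using sum_log_plus_rotations_ge[of z0 g] z0 by auto
  define a where "a = (\<lambda>m. (deriv ^^ m) h 0 / fact m)"
  define T where "T = (\<lambda>n z. \<Sum>m<n. a m * z ^ m)"
  define c' where "c' = 4 * (A + c)"
  have c': "c' \<ge> 0" using Ac by (simp add: c'_def)
  \<comment> \<open>Below, the average of \<open>ln\<^sup>+ |g|\<close> over the rotated points is at most \<open>4 * c' * \<epsilon>\<close>, which
    has to be smaller than the lower bound \<open>e\<close>.\<close>
  define \<epsilon> where "\<epsilon> = e / (4 * c' + 1)"
  have \<epsilon>: "\<epsilon> > 0" "4 * c' * \<epsilon> < e"
    using e(1) c' by (auto simp: \<epsilon>_def field_simps)
  have "summable (\<lambda>m. (norm (a m))\<^sup>2)"
    unfolding a_def by (rule square_summable_taylor[OF holh bdd])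
  then obtain N where N: "\<And>n. norm (\<Sum>m=N..<n. (norm (a m))\<^sup>2) < \<epsilon>"
    using \<epsilon>(1) unfolding summable_Cauchy by blast
  define M where "M = (\<Sum>m<N. norm (a m))"
  have TN: "norm (T N z) \<le> M" if "norm z \<le> 1" for z
    unfolding T_def M_def using that
    by (intro sum_norm_le) (auto simp: norm_mult norm_power intro!: mult_left_le power_le_one)
  \<comment> \<open>The threshold \<open>2 * M\<close> makes the remainder \<open>h - T N\<close> dominate \<open>h\<close>; the threshold \<open>1\<close> absorbs
    the additive constant \<open>A\<close> into \<open>A * (norm (h z))\<^sup>2\<close>.\<close>
  obtain \<rho> where \<rho>: "\<rho> < 1"
    "\<And>z. \<rho> \<le> norm z \<Longrightarrow> norm z < 1 \<Longrightarrow> norm (g z) > 1 \<Longrightarrow> max 1 (2 * M) \<le> norm (h z)"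
    using bdry[of "max 1 (2 * M)"] by blast
  obtain r where r: "max \<rho> (norm z0) < r" "r < 1"
    using dense[of "max \<rho> (norm z0)" 1] \<rho>(1) z0 by auto
  have r0: "r > 0" using r norm_ge_zero[of z0] by linarith

  have "\<forall>\<^sub>F n in sequentially. \<forall>z\<in>cball 0 r. dist (T n z) (h z) < sqrt \<epsilon>"
    using taylor_uniform_limit[OF holh r(2)] \<epsilon>(1)
    unfolding uniform_limit_iff T_def a_def by simp
  \<comment> \<open>The number \<open>n\<close> of rotated points is also the degree bound of a second Taylor polynomial,
    so that \<open>discrete_parseval\<close> applies to \<open>T n - T N\<close>.\<close>
  then obtain n where n: "n \<ge> max N 1" "\<And>z. norm z \<le> r \<Longrightarrow> dist (T n z) (h z) < sqrt \<epsilon>"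
    unfolding eventually_sequentially by (metis mem_cball_0 nle_le)

  have log_le: "ln (max 1 (norm (g z))) \<le> c' * (norm (h z - T N z))\<^sup>2" if z: "norm z = r" for z
  proof (cases "norm (g z) > 1")
    case True
    then have h: "1 \<le> norm (h z)" "2 * M \<le> norm (h z)"
      using \<rho>(2)[of z] z r by auto
    have "norm (h z) \<le> norm (h z - T N z) + M"
      using norm_triangle_sub[of "h z" "T N z"] TN[of z] z r by linarith
    then have "norm (h z) \<le> 2 * norm (h z - T N z)" using h(2) by linarith
    then have sq: "(norm (h z))\<^sup>2 \<le> 4 * (norm (h z - T N z))\<^sup>2"
      using power_mono[of "norm (h z)" "2 * norm (h z - T N z)" 2] by (simp add: power_mult_distrib)
    have "ln (max 1 (norm (g z))) = ln (norm (g z))" using True by simp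
    also have "\<dots> \<le> A + c * (norm (h z))\<^sup>2"
      using growth[of z] z r True ln_mono[of "norm (g z)" "exp (A + c * (norm (h z))\<^sup>2)"]
      by (cases "g z = 0") auto
    also have "\<dots> \<le> (A + c) * (norm (h z))\<^sup>2"
      using Ac mult_left_mono[of 1 "(norm (h z))\<^sup>2" A] h(1) by (simp add: distrib_right one_le_power)
    also have "\<dots> \<le> (A + c) * (4 * (norm (h z - T N z))\<^sup>2)"
      using Ac sq by (intro mult_left_mono) auto
    finally show ?thesis unfolding c'_def by (simp only: mult_ac)
  next
    case False
    then show ?thesis using c' by (simp add: max_def)
  qed

  have tail_le: "(\<Sum>k<n. (norm (h (cis (2 * pi * real k / real n) * z) - T N (cis (2 * pi * real k / real n) * z)))\<^sup>2)
      \<le> 4 * n * \<epsilon>" if z: "norm z = r" for z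
  proof -
    define b where "b = (\<lambda>m. if m < N then 0 else a m)"
    have split: "T n z - T N z = (\<Sum>m<n. b m * z ^ m)" for z
    proof -
      have "T n z = T N z + (\<Sum>m=N..<n. a m * z ^ m)"
        unfolding T_def lessThan_atLeast0 using n(1) by (simp add: sum.atLeastLessThan_concat)
      also have "(\<Sum>m=N..<n. a m * z ^ m) = (\<Sum>m<n. b m * z ^ m)"
        by (rule sum.mono_neutral_cong_left) (auto simp: b_def)
      finally show ?thesis by simp
    qed
    have "(\<Sum>m<n. (norm (b m))\<^sup>2 * r ^ (2 * m)) \<le> (\<Sum>m<n. (norm (b m))\<^sup>2)"
      using r r0 by (intro sum_mono mult_left_le power_le_one) auto
    also have "(\<Sum>m<n. (norm (b m))\<^sup>2) = (\<Sum>m=N..<n. (norm (a m))\<^sup>2)"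
      by (rule sum.mono_neutral_cong_right) (auto simp: b_def)
    also have "\<dots> \<le> \<epsilon>" using N[of n] by simp
    finally have b_le: "(\<Sum>m<n. (norm (b m))\<^sup>2 * r ^ (2 * m)) \<le> \<epsilon>" .
    let ?w = "\<lambda>k. cis (2 * pi * real k / real n) * z"
    have "(\<Sum>k<n. (norm (h (?w k) - T N (?w k)))\<^sup>2)
        \<le> (\<Sum>k<n. 2 * (norm (\<Sum>m<n. b m * ?w k ^ m))\<^sup>2 + 2 * \<epsilon>)"
    proof (rule sum_mono)
      fix k
      let ?u = "?w k"
      have "norm ?u = r" using z by (simp add: norm_mult)
      then have "norm (h ?u - T n ?u) \<le> sqrt \<epsilon>"
        using n(2)[of ?u] by (simp add: dist_norm norm_minus_commute)
      then have 1: "(norm (h ?u - T n ?u))\<^sup>2 \<le> \<epsilon>"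
        using \<epsilon>(1) power_mono[of "norm (h ?u - T n ?u)" "sqrt \<epsilon>" 2] by simp
      have "norm (h ?u - T N ?u) \<le> norm (T n ?u - T N ?u) + norm (h ?u - T n ?u)"
        using norm_triangle_ineq[of "T n ?u - T N ?u" "h ?u - T n ?u"] by simp
      then have "(norm (h ?u - T N ?u))\<^sup>2 \<le> (norm (T n ?u - T N ?u) + norm (h ?u - T n ?u))\<^sup>2"
        by (rule power_mono) simp
      also have "\<dots> \<le> 2 * (norm (T n ?u - T N ?u))\<^sup>2 + 2 * (norm (h ?u - T n ?u))\<^sup>2"
        using zero_le_power2[of "norm (T n ?u - T N ?u) - norm (h ?u - T n ?u)"]
        unfolding power2_sum power2_diff by linarith
      finally show "(norm (h ?u - T N ?u))\<^sup>2 \<le> 2 * (norm (\<Sum>m<n. b m * ?u ^ m))\<^sup>2 + 2 * \<epsilon>"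
        using 1 unfolding split by linarith
    qed
    also have "\<dots> = 2 * (n * (\<Sum>m<n. (norm (b m))\<^sup>2 * r ^ (2 * m))) + 2 * n * \<epsilon>"
      using discrete_parseval[of b n z] z by (simp add: sum.distrib flip: sum_distrib_left)
    also have "\<dots> \<le> 2 * (n * \<epsilon>) + 2 * n * \<epsilon>"
      using b_le by (intro add_right_mono mult_left_mono) auto
    finally show ?thesis by (simp add: mult_ac)
  qed

  have "(\<Sum>k<n. ln (max 1 (norm (g (cis (2 * pi * real k / real n) * z0))))) \<le> c' * (4 * n * \<epsilon>)"
  proof (rule sum_log_plus_rotations_le)
    show "g holomorphic_on ball 0 r" "continuous_on (cball 0 r) g"
      using r by (auto intro!: holomorphic_on_subset[OF holg] 
          continuous_on_subset[OF holomorphic_on_imp_continuous_on[OF holg]])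
    show "(\<Sum>k<n. ln (max 1 (norm (g (cis (2 * pi * real k / real n) * z))))) \<le> c' * (4 * n * \<epsilon>)"
      if z: "norm z = r" for z
    proof -
      have "(\<Sum>k<n. ln (max 1 (norm (g (cis (2 * pi * real k / real n) * z)))))
        \<le> (\<Sum>k<n. c' * (norm (h (cis (2 * pi * real k / real n) * z) - T N (cis (2 * pi * real k / real n) * z)))\<^sup>2)"
        using z by (intro sum_mono log_le) (simp add: norm_mult)
      also have "\<dots> \<le> c' * (4 * n * \<epsilon>)"
        unfolding sum_distrib_left [symmetric] using tail_le[OF z] c' by (intro mult_left_mono) auto
      finally show ?thesis .
    qed
  qed (use r in auto)
  with e(2)[of n] have "real n * e \<le> real n * (4 * c' * \<epsilon>)" by (simp add: mult_ac)
  moreover have "real n * (4 * c' * \<epsilon>) < real n * e"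
    using n(1) \<epsilon>(2) by (intro mult_strict_left_mono) auto
  ultimately show False by linarith
qed

section \<open>The Riemann map and its Hardy norm\<close>

lemma riemann_map_conformal:
  assumes "open W" "simply_connected W" "W \<noteq> UNIV" "a \<in> W"
  shows "conformal_onto (riemann_map W a) (ball 0 1) W" "riemann_map W a 0 = a"
proof -
  obtain f g where fg: "g holomorphic_on ball 0 1"
      "\<And>z. z \<in> W \<Longrightarrow> f z \<in> ball 0 1 \<and> g (f z) = z"
      "\<And>z. z \<in> ball 0 1 \<Longrightarrow> g z \<in> W \<and> f (g z) = z"
    using simply_connected_eq_biholomorphic_to_disc[OF assms(1)] assms by blast
  have "f a \<in> ball 0 1" using fg(2) assms(4) by blast
  then obtain m k where mk: "m (f a) = 0" "m holomorphic_on ball 0 1" "m ` ball 0 1 \<subseteq> ball 0 1"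
      "k holomorphic_on ball 0 1" "k ` ball 0 1 \<subseteq> ball 0 1"
      "\<And>z. z \<in> ball 0 1 \<Longrightarrow> m (k z) = z" "\<And>z. z \<in> ball 0 1 \<Longrightarrow> k (m z) = z"
    by (rule ball_biholomorphism_exists) (rule that)
  have "conformal_onto (g \<circ> k) (ball 0 1) W"
    unfolding conformal_onto_def
  proof (intro conjI)
    show "g \<circ> k holomorphic_on ball 0 1"
      using mk fg(1) by (intro holomorphic_on_compose_gen)
    show "inj_on (g \<circ> k) (ball 0 1)"
      using fg(3) mk by (intro inj_on_inverseI[where g = "m \<circ> f"]) (auto simp: image_subset_iff)
    show "(g \<circ> k) ` ball 0 1 = W"
    proof
      show "(g \<circ> k) ` ball 0 1 \<subseteq> W" using fg(3) mk(5) by auto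
      show "W \<subseteq> (g \<circ> k) ` ball 0 1"
      proof
        fix w assume "w \<in> W"
        then have "w = (g \<circ> k) (m (f w))" "m (f w) \<in> ball 0 1"
          using fg(2)[of w] mk(3) mk(7)[of "f w"] by (auto simp: image_subset_iff)
        then show "w \<in> (g \<circ> k) ` ball 0 1" by blast
      qed
    qed
  qed
  moreover have "(g \<circ> k) 0 = a"
    using mk(1) mk(7)[of "f a"] fg(2)[OF assms(4)] by simp
  ultimately have "\<exists>\<phi>. conformal_onto \<phi> (ball 0 1) W \<and> \<phi> 0 = a" by blast
  then show "conformal_onto (riemann_map W a) (ball 0 1) W" "riemann_map W a 0 = a"
    unfolding riemann_map_def by (metis (mono_tags, lifting) someI_ex)+
qed

lemma hardy_norm_finite_imp_means_bounded:
  assumes "hardy_norm p \<phi> < \<infinity>"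
  obtains B where "\<And>r. 0 \<le> r \<Longrightarrow> r < 1 \<Longrightarrow> integral_mean p \<phi> r \<le> B"
proof -
  let ?S = "SUP r\<in>{0..<1}. ennreal (integral_mean p \<phi> r)"
  have fin: "?S \<noteq> \<infinity>"
    using assms unfolding hardy_norm_def ennreal_powr_def by (auto split: if_splits)
  have "integral_mean p \<phi> r \<le> enn2real ?S" if "0 \<le> r" "r < 1" for r
  proof -
    have "ennreal (integral_mean p \<phi> r) \<le> ?S"
      using that by (intro SUP_upper) auto
    also have "?S = ennreal (enn2real ?S)"
      using fin by (metis ennreal_enn2real infinity_ennreal_def less_top)
    finally show ?thesis by (simp add: ennreal_le_iff)
  qed
  then show ?thesis by (rule that)
qed

lemma powr_add_le:
  fixes x y p :: real
  assumes "x \<ge> 0" "y \<ge> 0" "p > 0"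
  shows "(x + y) powr p \<le> 2 powr p * (x powr p + y powr p)"
proof -
  have "(x + y) powr p \<le> (2 * max x y) powr p"
    using assms by (intro powr_mono2) auto
  also have "\<dots> = 2 powr p * max x y powr p"
    using assms by (simp add: powr_mult)
  also have "max x y powr p \<le> x powr p + y powr p"
    by (simp add: max_def)
  finally show ?thesis by simp
qed

text \<open>
  The function \<open>\<phi> - w0\<close> has no zeros in the disc, so it has a holomorphic logarithm and thus a holomorphic
  power of exponent \<open>p / 2\<close>. This replaces \<open>\<phi>\<close> in the Hardy space of exponent \<open>p\<close> by a function of
  exponent \<open>2\<close>, for which Parseval's identity is available.
\<close>

lemma hardy_root:
  fixes \<phi> :: "complex \<Rightarrow> complex"
  assumes hol: "\<phi> holomorphic_on ball 0 1" and w0: "\<And>z. z \<in> ball 0 1 \<Longrightarrow> \<phi> z \<noteq> w0"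
  obtains h where "h holomorphic_on ball 0 1" 
    "\<And>z. z \<in> ball 0 1 \<Longrightarrow> (norm (h z))\<^sup>2 = norm (\<phi> z - w0) powr p"
proof -
  have "(\<lambda>z. \<phi> z - w0) holomorphic_on ball 0 1" by (intro holomorphic_intros hol)
  then obtain L where L: "L holomorphic_on ball 0 1" "\<And>z. z \<in> ball 0 1 \<Longrightarrow> \<phi> z - w0 = exp (L z)"
    using contractible_imp_holomorphic_log[of "\<lambda>z. \<phi> z - w0" "ball 0 1"] w0
    by (metis convex_ball convex_imp_contractible right_minus_eq)
  show ?thesis
  proof
    show "(\<lambda>z. exp (of_real (p / 2) * L z)) holomorphic_on ball 0 1"
      by (intro holomorphic_intros L)
    show "(norm (exp (of_real (p / 2) * L z)))\<^sup>2 = norm (\<phi> z - w0) powr p" if "z \<in> ball 0 1" for z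
      by (simp add: L(2)[OF that] powr_def flip: exp_double)
  qed
qed

lemma integral_mean_shift_bounded:
  assumes hol: "\<phi> holomorphic_on ball 0 1" and p: "p > 0" and r: "0 < r" "r < 1"
  shows "integral {0..2 * pi} (\<lambda>t. norm (\<phi> (of_real r * cis t) - w0) powr p)
       \<le> 2 * pi * 2 powr p * (integral_mean p \<phi> r + norm w0 powr p)"
proof -
  have cont: "continuous_on {0..2 * pi} (\<lambda>t. \<phi> (of_real r * cis t))"
    using r by (intro continuous_intros continuous_on_compose2[OF holomorphic_on_imp_continuous_on[OF hol]])
      (auto simp: norm_mult)
  have int: "(\<lambda>t. norm (\<phi> (of_real r * cis t) - w) powr p) integrable_on {0..2 * pi}" for w
    using p by (intro integrable_continuous_real continuous_on_powr' continuous_intros cont) auto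
  have "integral {0..2 * pi} (\<lambda>t. norm (\<phi> (of_real r * cis t) - w0) powr p)
     \<le> integral {0..2 * pi} (\<lambda>t. 2 powr p * (norm (\<phi> (of_real r * cis t)) powr p + norm w0 powr p))"
  proof (rule integral_le)
    show "(\<lambda>t. 2 powr p * (norm (\<phi> (of_real r * cis t)) powr p + norm w0 powr p)) integrable_on {0..2 * pi}"
      using p by (intro integrable_continuous_real continuous_on_powr' continuous_intros cont) auto
    fix t
    show "norm (\<phi> (of_real r * cis t) - w0) powr p \<le> 2 powr p * (norm (\<phi> (of_real r * cis t)) powr p + norm w0 powr p)"
      using p by (intro order_trans[OF powr_mono2 powr_add_le] norm_triangle_ineq4) auto
  qed (rule int)
  also have "\<dots> = 2 powr p * (integral {0..2 * pi} (\<lambda>t. norm (\<phi> (of_real r * cis t)) powr p) + 2 * pi * norm w0 powr p)"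
  proof -
    have "integral {0..2 * pi} (\<lambda>t. norm (\<phi> (of_real r * cis t)) powr p + norm w0 powr p)
      = integral {0..2 * pi} (\<lambda>t. norm (\<phi> (of_real r * cis t)) powr p) + integral {0..2 * pi} (\<lambda>t. norm w0 powr p)"
      by (rule integral_add) (use int[of 0] in \<open>auto intro: integrable_continuous_real\<close>)
    then show ?thesis by simp
  qed
  also have "\<dots> = 2 * pi * 2 powr p * (integral_mean p \<phi> r + norm w0 powr p)"
    by (simp add: integral_mean_def algebra_simps)
  finally show ?thesis .
qed

section \<open>Boundary behaviour in the domain\<close>

text \<open>
  A point of \<open>W\<close> in the closure belongs to the set by continuity, and a boundary point of \<open>W\<close> cannot be
  in the closure, since \<open>|f| < K\<close> near it. In this form the boundary condition can be pulled back to the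
  disc without any boundary values of the Riemann map.
\<close>

lemma compact_superlevel:
  assumes holf: "f holomorphic_on W"
    and lim: "\<And>\<zeta>. \<zeta> \<in> frontier W \<Longrightarrow> Limsup (at \<zeta> within W) (\<lambda>z. ereal (norm (f z))) < ereal K"
    and "open W"
  shows "compact {w\<in>W. norm w \<le> R \<and> K \<le> norm (f w)}" (is "compact ?X")
proof -
  have "closed ?X"
    unfolding closure_subset_eq [symmetric]
  proof
    fix x assume x: "x \<in> closure ?X"
    have "norm x \<le> R"
    proof -
      have "?X \<subseteq> cball 0 R" by auto
      then have "closure ?X \<subseteq> cball 0 R" by (rule closure_minimal) simp
      then show ?thesis using subsetD[OF _ x] by fastforce
    qed
    have near: "\<exists>y\<in>W. dist y x < d \<and> K \<le> norm (f y)" if "d > 0" for d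
      using closure_approachable[THEN iffD1, OF x, rule_format, OF that] by auto
    show "x \<in> ?X"
    proof (rule ccontr)
      assume nx: "x \<notin> ?X"
      have "\<exists>d>0. \<forall>y\<in>W. dist y x < d \<longrightarrow> norm (f y) < K"
      proof (cases "x \<in> W")
        case True
        then have fx: "norm (f x) < K" using nx \<open>norm x \<le> R\<close> by auto
        have "((\<lambda>y. norm (f y)) \<longlongrightarrow> norm (f x)) (at x within W)"
          using holomorphic_on_imp_continuous_on[OF holf] True
          by (intro tendsto_norm) (simp add: continuous_on_def)
        then have "\<forall>\<^sub>F y in at x within W. norm (f y) < K"
          using fx by (rule order_tendstoD)
        then show ?thesis using fx unfolding eventually_at by metis
      next
        case False
        have "x \<in> closure W" using x closure_mono[of ?X W] by auto
        then have "x \<in> frontier W" using False \<open>open W\<close> by (simp add: frontier_def interior_open)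
        from Limsup_lessD[OF lim[OF this]]
        have "\<forall>\<^sub>F y in at x within W. norm (f y) < K" by simp
        then show ?thesis using False unfolding eventually_at by metis
      qed
      then show False using near by (meson not_le)
    qed
  qed
  moreover have "bounded ?X"
    by (rule boundedI[of _ R]) auto
  ultimately show ?thesis by (simp add: compact_eq_bounded_closed)
qed

text \<open>
  A boundary point of an open set is a limit point of it, so the upper limit of a norm there is
  nonnegative. This makes every bound above \<open>K\<close> positive, so that \<open>f\<close> can be divided by it.
\<close>

lemma Limsup_norm_nonneg:
  assumes "open W" "W \<noteq> {}" "\<zeta> \<in> frontier W"
    and "Limsup (at \<zeta> within W) (\<lambda>z. ereal (norm (f z))) \<le> ereal K"
  shows "K \<ge> 0"
proof -
  have "\<zeta> \<in> closure W" "\<zeta> \<notin> W"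
    using assms by (auto simp: frontier_def interior_open)
  then have "at \<zeta> within W \<noteq> bot"
    by (simp add: trivial_limit_within closure_def)
  then have "0 \<le> Limsup (at \<zeta> within W) (\<lambda>z. ereal (norm (f z)))"
    by (intro le_Limsup) auto
  then show ?thesis using assms(4) by (metis ereal_less_eq(5) order_trans)
qed

section \<open>The Phragmen-Lindelof principle\<close>

theorem theorem1:
  fixes p K C :: real and W :: "complex set" and f :: "complex \<Rightarrow> complex"
  assumes "p > 0"
    and "open W" and "W \<noteq> {}" and "simply_connected W" and "W \<noteq> UNIV"
    and "finite_hardy p W"
    and "f holomorphic_on W"
    and "\<forall>\<zeta>\<in>frontier W. Limsup (at \<zeta> within W) (\<lambda>z. ereal (norm (f z))) \<le> ereal K"
    and "C > 0"
    and "\<forall>z\<in>W. norm (f z) \<le> C * exp (C * norm z powr p)"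
  shows "\<forall>z\<in>W. norm (f z) \<le> K"
proof -
  obtain a where a: "a \<in> W" "domain_hardy_norm p a W < \<infinity>"
    using assms(6) unfolding finite_hardy_def by blast
  define \<phi> where "\<phi> = riemann_map W a"
  have \<phi>: "\<phi> holomorphic_on ball 0 1" "inj_on \<phi> (ball 0 1)" "\<phi> ` ball 0 1 = W"
    using riemann_map_conformal(1)[OF assms(2,4,5) a(1)] by (auto simp: \<phi>_def conformal_onto_def)
  obtain B where B: "\<And>r. 0 \<le> r \<Longrightarrow> r < 1 \<Longrightarrow> integral_mean p \<phi> r \<le> B"
    using hardy_norm_finite_imp_means_bounded a(2) unfolding domain_hardy_norm_def \<phi>_def by metis
  \<comment> \<open>Any value omitted by \<open>\<phi>\<close> serves to form \<open>h = (\<phi> - w0) powr (p / 2)\<close>.\<close>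
  obtain w0 where w0: "w0 \<notin> W" using assms(5) by blast
  obtain h where h: "h holomorphic_on ball 0 1"
    "\<And>z. z \<in> ball 0 1 \<Longrightarrow> (norm (h z))\<^sup>2 = norm (\<phi> z - w0) powr p"
    using hardy_root[OF \<phi>(1), of w0 p] \<phi>(3) w0 by blast
  have h_means: "integral {0..2 * pi} (\<lambda>t. (norm (h (of_real r * cis t)))\<^sup>2)
      \<le> 2 * pi * 2 powr p * (B + norm w0 powr p)" if r: "0 < r" "r < 1" for r
  proof -
    have "integral {0..2 * pi} (\<lambda>t. (norm (h (of_real r * cis t)))\<^sup>2)
        = integral {0..2 * pi} (\<lambda>t. norm (\<phi> (of_real r * cis t) - w0) powr p)"
      using r by (intro integral_cong h(2)) (auto simp: norm_mult)
    also have "\<dots> \<le> 2 * pi * 2 powr p * (integral_mean p \<phi> r + norm w0 powr p)"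
      by (rule integral_mean_shift_bounded[OF \<phi>(1) assms(1) r])
    also have "\<dots> \<le> 2 * pi * 2 powr p * (B + norm w0 powr p)"
      using B[of r] r by (intro mult_left_mono add_right_mono) auto
    finally show ?thesis .
  qed

  obtain \<psi> where \<psi>: "\<psi> holomorphic_on W" "\<And>z. z \<in> ball 0 1 \<Longrightarrow> \<psi> (\<phi> z) = z"
    using holomorphic_has_inverse[OF \<phi>(1) open_ball \<phi>(2)] \<phi>(3) by metis

  have "frontier W \<noteq> {}"
    using assms(3,5) by (simp add: frontier_eq_empty)
  then have K: "K \<ge> 0"
    using Limsup_norm_nonneg[OF assms(2,3)] assms(8) by blast

  \<comment> \<open>The upper limits at the boundary are strictly below \<open>K'\<close>, hence so is \<open>|f|\<close> near each boundary
    point; for \<open>K\<close> itself this need not hold.\<close>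
  have bound: "norm (f (\<phi> z0)) \<le> K'" if K': "K' > K" and z0: "norm z0 < 1" for K' z0
  proof -
    have K'0: "K' > 0" using K K' by linarith
    define g where "g = (\<lambda>z. f (\<phi> z) / of_real K')"
    have norm_g: "norm (g z) = norm (f (\<phi> z)) / K'" for z
      using K'0 by (simp add: g_def norm_divide)
    define c where "c = C * 2 powr p"
    define A where "A = \<bar>ln (C / K')\<bar> + c * norm w0 powr p"
    have c: "c \<ge> 0" using assms(9) by (simp add: c_def)
    have "norm (g z0) \<le> 1"
    proof (rule phragmen_lindelof_disc[where g = g and h = h and A = A and c = c, OF _ h(1) h_means])
      show "g holomorphic_on ball 0 1"
        unfolding g_def using K'0 \<phi> holomorphic_on_compose_gen[OF \<phi>(1) assms(7)]
        by (intro holomorphic_intros) (auto simp: o_def)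
      show "A \<ge> 0" "c \<ge> 0" using c by (auto simp: A_def)
      show "norm (g z) \<le> exp (A + c * (norm (h z))\<^sup>2)" if z: "norm z < 1" for z
      proof -
        have "norm (\<phi> z) powr p \<le> (norm (\<phi> z - w0) + norm w0) powr p"
          using assms(1) norm_triangle_sub[of "\<phi> z" w0] by (intro powr_mono2) (auto simp: add.commute)
        also have "\<dots> \<le> 2 powr p * ((norm (h z))\<^sup>2 + norm w0 powr p)"
          using powr_add_le[of "norm (\<phi> z - w0)" "norm w0" p] assms(1) h(2)[of z] z by simp
        finally have "C * norm (\<phi> z) powr p \<le> c * ((norm (h z))\<^sup>2 + norm w0 powr p)"
          using assms(9) by (simp add: c_def mult.assoc)
        moreover have "norm (f (\<phi> z)) \<le> C * exp (C * norm (\<phi> z) powr p)"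
          using assms(10) \<phi>(3) z by auto
        ultimately have "norm (f (\<phi> z)) \<le> C * exp (c * ((norm (h z))\<^sup>2 + norm w0 powr p))"
          using assms(9) by (smt (verit) exp_le_cancel_iff mult_left_mono)
        then have "norm (g z) \<le> C / K' * exp (c * ((norm (h z))\<^sup>2 + norm w0 powr p))"
          using K'0 by (simp add: norm_g divide_right_mono)
        also have "C / K' = exp (ln (C / K'))" using assms(9) K'0 by simp
        also have "exp (ln (C / K')) * exp (c * ((norm (h z))\<^sup>2 + norm w0 powr p))
            \<le> exp (A + c * (norm (h z))\<^sup>2)"
          unfolding exp_add [symmetric] by (simp add: A_def algebra_simps)
        finally show ?thesis .
      qed
      show "\<exists>\<rho><1. \<forall>z. \<rho> \<le> norm z \<longrightarrow> norm z < 1 \<longrightarrow> norm (g z) > 1 \<longrightarrow> M \<le> norm (h z)" for M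
      proof -
        \<comment> \<open>The set \<open>norm (h z) \<le> M\<close> is mapped by \<open>\<phi>\<close> into the disc of radius \<open>R\<close>. The part of that disc
          where \<open>|f| \<ge> K'\<close> is compact in \<open>W\<close>, so its preimage stays away from the unit circle.\<close>
        define R where "R = norm w0 + (M\<^sup>2) powr (1 / p)"
        let ?X = "{w\<in>W. norm w \<le> R \<and> K' \<le> norm (f w)}"
        have "Limsup (at \<zeta> within W) (\<lambda>z. ereal (norm (f z))) < ereal K'" if "\<zeta> \<in> frontier W" for \<zeta>
          using assms(8) that K' by (meson ereal_less_eq(3) le_less_trans less_ereal.simps(1))
        then have "compact ?X"
          by (intro compact_superlevel assms(2,7)) auto
        then have cX: "compact (\<psi> ` ?X)"
          by (rule compact_continuous_image[rotated])
            (auto intro: continuous_on_subset[OF holomorphic_on_imp_continuous_on[OF \<psi>(1)]])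
        have sub: "\<psi> ` ?X \<subseteq> ball 0 1" using \<psi>(2) \<phi>(3) by fastforce
        have "\<exists>\<rho><1. \<forall>z\<in>\<psi> ` ?X. norm z < \<rho>"
        proof (cases "\<psi> ` ?X = {}")
          case True
          then show ?thesis by (intro exI[of _ 0]) auto
        next
          case False
          then obtain x where x: "x \<in> \<psi> ` ?X" "\<And>y. y \<in> \<psi> ` ?X \<Longrightarrow> norm y \<le> norm x"
            using continuous_attains_sup[OF cX False, of norm] by (auto intro: continuous_intros)
          have "norm x < 1" using x(1) sub by auto
          then obtain \<rho> where "norm x < \<rho>" "\<rho> < 1" using dense by blast
          then show ?thesis using x(2) by (meson le_less_trans)
        qed
        then obtain \<rho> where \<rho>: "\<rho> < 1" "\<And>z. z \<in> \<psi> ` ?X \<Longrightarrow> norm z < \<rho>" by blast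
        show ?thesis
        proof (intro exI[of _ \<rho>] conjI allI impI \<rho>(1))
          fix z assume z: "\<rho> \<le> norm z" "norm z < 1" "norm (g z) > 1"
          have zb: "z \<in> ball 0 1" using z by simp
          show "M \<le> norm (h z)"
          proof (rule ccontr)
            assume "\<not> M \<le> norm (h z)"
            then have "(norm (h z))\<^sup>2 \<le> M\<^sup>2" by (intro power_mono) auto
            then have "norm (\<phi> z - w0) powr p \<le> M\<^sup>2" using h(2)[OF zb] by simp
            then have "(norm (\<phi> z - w0) powr p) powr (1 / p) \<le> (M\<^sup>2) powr (1 / p)"
              using assms(1) by (intro powr_mono2) auto
            then have "norm (\<phi> z - w0) \<le> (M\<^sup>2) powr (1 / p)"
              using assms(1) by (simp add: powr_powr)
            then have "norm (\<phi> z) \<le> R"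
              unfolding R_def using norm_triangle_sub[of "\<phi> z" w0] by linarith
            moreover have "K' \<le> norm (f (\<phi> z))"
              using z(3) K'0 by (simp add: norm_g field_simps)
            ultimately have "\<phi> z \<in> ?X" using \<phi>(3) zb by auto
            then have "z \<in> \<psi> ` ?X" using \<psi>(2)[OF zb] by (metis imageI)
            then show False using \<rho>(2) z(1) by fastforce
          qed
        qed
      qed
    qed (use z0 in auto)
    then show ?thesis using K'0 by (simp add: norm_g)
  qed
  show ?thesis
  proof
    fix z assume "z \<in> W"
    then obtain z0 where "norm z0 < 1" "z = \<phi> z0" using \<phi>(3) by force
    then show "norm (f z) \<le> K" using bound by (auto intro: dense_ge)
  qed
qed

end
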